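(* Let $F_1,\dots,F_K:\mathbb{R}^d\to\mathbb{R}$ be $L$-smooth and $\lambda$-strongly convex with $\lambda>0$, let $f=\frac1K\sum_{k=1}^K F_k$ and $\hat w=\arg\min_w f(w)$. Let $$\tilde\rho:=\left[\frac{(1-\gamma)^2}{\eta(L+\mu)}-\frac{2L}{(\lambda+\mu)^2}-\frac{2\gamma(L+\mu)}{\eta(\lambda+\mu)^2}\right]\eta^2\lambda,$$ and suppose that $\eta>0$, $0\le\gamma<1$ and $\mu>0$ are chosen such that $0<\tilde\rho<1$. Then the iterates $\{w^t\}$ of INEXACTDANE with Option II applied to $f=\frac1K\sum_kF_k$ with parameters $\mu,\eta,\gamma$, from any initial point $w^0\in\mathbb{R}^d$, satisfy for all $t\ge1$ $$f(w^t)-f(\hat w)\le(1-\tilde\rho)\bigl(f(w^{t-1})-f(\hat w)\bigr).$$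
   Context: A function $\psi:\mathbb{R}^d\to\mathbb{R}$ is $L$-smooth if it is differentiable and $\|\nabla\psi(x)-\nabla\psi(y)\|\le L\|x-y\|$ for all $x,y$; a differentiable $\psi$ is $\lambda$-strongly convex if $\psi(x)\ge\psi(y)+\langle\nabla\psi(y),x-y\rangle+\frac\lambda2\|x-y\|^2$ for all $x,y$. $\|\cdot\|$ is the Euclidean norm. INEXACTDANE (Option II) for $f=\frac1K\sum_{k=1}^K F_k$ with parameters $\mu\ge0$, $\eta>0$, $0\le\gamma<1$: starting from $w^0$, for $t=1,2,\dots$ and each $k\in\{1,\dots,K\}$ set $$g^t_{k,\mu}(w)=F_k(w)-\langle\nabla F_k(w^{t-1})-\eta\nabla f(w^{t-1}),w\rangle+\tfrac{\mu}{2}\|w-w^{t-1}\|^2,\qquad \hat w_k^t=\arg\min_w g^t_{k,\mu}(w),$$ let $w_k^t$ be any point satisfying both $\|\nabla g^t_{k,\mu}(w_k^t)\|\le\gamma\|\nabla g^t_{k,\mu}(w^{t-1})\|$ and $\|w_k^t-\hat w_k^t\|\le\gamma\|w^{t-1}-\hat w_k^t\|$, and put $w^t=\frac1K\sum_{k=1}^K w_k^t$. *)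

theory Defs
  imports "HOL-Analysis.Analysis"
begin

definition gradient :: "('a::euclidean_space \<Rightarrow> real) \<Rightarrow> 'a \<Rightarrow> 'a" where
  "gradient f x = (THE g. GDERIV f x :> g)"

(* At points of non-differentiability the value of gradient is unspecified; the next two
   facts say that it is the usual gradient wherever one exists. *)

lemma gradient_eqI:
  assumes "GDERIV f x :> g"
  shows "gradient f x = g"
  unfolding gradient_def
proof (rule the_equality)
  show "GDERIV f x :> g" by (fact assms)
next
  fix h assume "GDERIV f x :> h"
  then have "(\<lambda>v. v \<bullet> h) = (\<lambda>v. v \<bullet> g)"
    using assms has_derivative_unique unfolding gderiv_def by blast
  then have "v \<bullet> h = v \<bullet> g" for v by metis
  then show "h = g" by (metis inner_commute vector_eq_rdot)
qed

lemma differentiable_GDERIV_gradient: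
  fixes f :: "'a::euclidean_space \<Rightarrow> real"
  assumes "f differentiable (at x)"
  shows "GDERIV f x :> gradient f x"
proof -
  obtain D where D: "(f has_derivative D) (at x)"
    using assms unfolding differentiable_def by blast
  then interpret D: bounded_linear D by (rule has_derivative_bounded_linear)
  have "D = (\<lambda>h. h \<bullet> (\<Sum>b\<in>Basis. D b *\<^sub>R b))"
  proof
    fix h
    have "D h = D (\<Sum>b\<in>Basis. (h \<bullet> b) *\<^sub>R b)"
      by (simp add: euclidean_representation)
    also have "\<dots> = h \<bullet> (\<Sum>b\<in>Basis. D b *\<^sub>R b)"
      by (simp add: D.sum D.scaleR inner_sum_right mult.commute)
    finally show "D h = h \<bullet> (\<Sum>b\<in>Basis. D b *\<^sub>R b)" .
  qed
  with D have "GDERIV f x :> (\<Sum>b\<in>Basis. D b *\<^sub>R b)"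
    unfolding gderiv_def by simp
  then show ?thesis using gradient_eqI by metis
qed

definition smooth_with :: "real \<Rightarrow> ('a::euclidean_space \<Rightarrow> real) \<Rightarrow> bool" where
  "smooth_with L \<psi> \<longleftrightarrow>
     (\<forall>x. \<psi> differentiable (at x)) \<and>
     (\<forall>x y. norm (gradient \<psi> x - gradient \<psi> y) \<le> L * norm (x - y))"

definition strongly_convex :: "real \<Rightarrow> ('a::euclidean_space \<Rightarrow> real) \<Rightarrow> bool" where
  "strongly_convex m \<psi> \<longleftrightarrow>
     (\<forall>x. \<psi> differentiable (at x)) \<and>
     (\<forall>x y. \<psi> x \<ge> \<psi> y + gradient \<psi> y \<bullet> (x - y) + m / 2 * (norm (x - y))\<^sup>2)"

definition average :: "nat \<Rightarrow> (nat \<Rightarrow> 'a \<Rightarrow> real) \<Rightarrow> 'a \<Rightarrow> real" where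
  "average K F w = (1 / real K) * (\<Sum>k=1..K. F k w)"

abbreviation is_argmin :: "('a \<Rightarrow> real) \<Rightarrow> 'a \<Rightarrow> bool" where
  "is_argmin h w \<equiv> is_arg_min h (\<lambda>_. True) w"

definition dane_subproblem ::
    "nat \<Rightarrow> (nat \<Rightarrow> 'a::euclidean_space \<Rightarrow> real) \<Rightarrow> real \<Rightarrow> real \<Rightarrow> nat \<Rightarrow> 'a \<Rightarrow> 'a \<Rightarrow> real" where
  "dane_subproblem K F \<mu> \<eta> k v w =
     F k w - (gradient (F k) v - \<eta> *\<^sub>R gradient (average K F) v) \<bullet> w
       + \<mu> / 2 * (norm (w - v))\<^sup>2"

(* The inexact subproblem solutions are not determined by the previous iterate, so the
   algorithm is modelled as a predicate on iterate sequences: w is a possible run started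
   at w 0, with u t k the chosen inexact solution of the k-th subproblem in round t. *)
definition inexact_dane_II_run ::
    "nat \<Rightarrow> (nat \<Rightarrow> 'a::euclidean_space \<Rightarrow> real) \<Rightarrow> real \<Rightarrow> real \<Rightarrow> real \<Rightarrow> (nat \<Rightarrow> 'a) \<Rightarrow> bool" where
  "inexact_dane_II_run K F \<mu> \<eta> \<gamma> w \<longleftrightarrow>
     (\<exists>u. \<forall>t\<ge>1.
        (\<forall>k\<in>{1..K}.
           (let g = dane_subproblem K F \<mu> \<eta> k (w (t - 1)) in
             norm (gradient g (u t k)) \<le> \<gamma> * norm (gradient g (w (t - 1))) \<and>
             (\<exists>w_opt. is_argmin g w_opt \<and>
                norm (u t k - w_opt) \<le> \<gamma> * norm (w (t - 1) - w_opt)))) \<and>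
        w t = (1 / real K) *\<^sub>R (\<Sum>k=1..K. u t k))"

end

theory Submission
  imports Defs
begin

text \<open>
  Write \<open>v\<close> for the previous iterate and \<open>g\<close> for the \<open>k\<close>-th subproblem. Its gradient at \<open>v\<close> is
  \<open>\<eta> \<nabla>f(v)\<close>, and \<open>g\<close> is \<open>(L + \<mu>)\<close>-smooth and \<open>(\<lambda> + \<mu>)\<close>-strongly convex. Hence the exact minimiser
  \<open>z\<close> of \<open>g\<close> satisfies \<open>\<langle>\<nabla>g(v), z - v\<rangle> \<le> - \<parallel>\<nabla>g(v)\<parallel>\<^sup>2 / (2 (L + \<mu>))\<close> and
  \<open>\<parallel>v - z\<parallel> \<le> \<parallel>\<nabla>g(v)\<parallel> / (\<lambda> + \<mu>)\<close>, and the inexact solution \<open>u\<close> lies within \<open>\<gamma> \<parallel>v - z\<parallel>\<close> of \<open>z\<close>.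
  Inserting this into the quadratic upper bound for \<open>f\<close> at \<open>v\<close> shows that \<open>f\<close> drops from \<open>v\<close> to \<open>u\<close>
  by at least \<open>\<rho> / (2\<lambda>) \<parallel>\<nabla>f(v)\<parallel>\<^sup>2\<close>. The second-order term costs \<open>(1 + \<gamma>)\<^sup>2 \<le> 2\<close>, which is implied by
  \<open>\<rho> > 0\<close>. Convexity transfers the decrease to the average of the local solutions, and the
  Polyak-Lojasiewicz inequality turns it into a contraction of the optimality gap.
\<close>

section \<open>Smoothness and strong convexity with explicit gradients\<close>

lemma smooth_withD_GDERIV: "smooth_with L \<psi> \<Longrightarrow> GDERIV \<psi> x :> gradient \<psi> x"
  by (simp add: smooth_with_def differentiable_GDERIV_gradient)

text \<open>Lets the property be checked on an explicit gradient field instead of the definite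
  description behind \<open>gradient\<close>; averages and subproblems are handled this way.\<close>

lemma smooth_withI_GDERIV:
  assumes "\<And>x. GDERIV \<psi> x :> G x" and "\<And>x y. norm (G x - G y) \<le> L * norm (x - y)"
  shows "smooth_with L \<psi>"
  using assms gradient_eqI[OF assms(1)] unfolding smooth_with_def differentiable_def gderiv_def
  by auto

lemma strongly_convexD:
  "strongly_convex m \<psi> \<Longrightarrow> \<psi> y + gradient \<psi> y \<bullet> (x - y) + m / 2 * (norm (x - y))\<^sup>2 \<le> \<psi> x"
  by (simp add: strongly_convex_def)

lemma strongly_convexI_GDERIV:
  assumes "\<And>x. GDERIV \<psi> x :> G x"
    and "\<And>x y. \<psi> y + G y \<bullet> (x - y) + m / 2 * (norm (x - y))\<^sup>2 \<le> \<psi> x"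
  shows "strongly_convex m \<psi>"
  using assms gradient_eqI[OF assms(1)] unfolding strongly_convex_def differentiable_def gderiv_def
  by auto

section \<open>Inequalities for smooth and strongly convex functions\<close>

text \<open>On the ray from \<open>x\<close> through \<open>y\<close>, the gap \<open>h\<close>
  between the function and its quadratic model has nonpositive derivative, by Cauchy-Schwarz and the
  Lipschitz gradient. Monotonicity from 0 to 1 then replaces the usual integral.\<close>

lemma smooth_with_quadratic_upper_bound:
  assumes "smooth_with L \<psi>"
  shows "\<psi> y \<le> \<psi> x + gradient \<psi> x \<bullet> (y - x) + L / 2 * (norm (y - x))\<^sup>2"
proof -
  define d where "d = y - x"
  define h where "h s = \<psi> (x + s *\<^sub>R d) - s * (gradient \<psi> x \<bullet> d) - L / 2 * s\<^sup>2 * (norm d)\<^sup>2" for s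
  have "\<exists>D. DERIV h s :> D \<and> D \<le> 0" if "0 \<le> s" for s
  proof (intro exI conjI)
    have "(\<psi> has_derivative (\<lambda>v. v \<bullet> gradient \<psi> (x + s *\<^sub>R d))) (at (x + s *\<^sub>R d))"
      using smooth_withD_GDERIV[OF assms] unfolding gderiv_def by blast
    then have "((\<lambda>s. \<psi> (x + s *\<^sub>R d)) has_derivative (\<lambda>r. (r *\<^sub>R d) \<bullet> gradient \<psi> (x + s *\<^sub>R d))) (at s)"
      by (rule has_derivative_compose[rotated]) (auto intro!: derivative_eq_intros)
    then have "DERIV (\<lambda>s. \<psi> (x + s *\<^sub>R d)) s :> d \<bullet> gradient \<psi> (x + s *\<^sub>R d)"
      by (rule has_derivative_imp_has_field_derivative) simp
    then show "DERIV h s :> (gradient \<psi> (x + s *\<^sub>R d) - gradient \<psi> x) \<bullet> d - L * s * (norm d)\<^sup>2"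
      unfolding h_def by (auto intro!: derivative_eq_intros simp: inner_diff_right inner_commute)
    have "(gradient \<psi> (x + s *\<^sub>R d) - gradient \<psi> x) \<bullet> d
        \<le> norm (gradient \<psi> (x + s *\<^sub>R d) - gradient \<psi> x) * norm d"
      by (rule norm_cauchy_schwarz)
    also have "\<dots> \<le> (L * norm ((x + s *\<^sub>R d) - x)) * norm d"
      using assms unfolding smooth_with_def by (intro mult_right_mono) (blast, simp)
    finally show "(gradient \<psi> (x + s *\<^sub>R d) - gradient \<psi> x) \<bullet> d - L * s * (norm d)\<^sup>2 \<le> 0"
      using that by (simp add: power2_eq_square mult.assoc)
  qed
  then have "h 1 \<le> h 0"
    by (rule DERIV_nonpos_imp_nonincreasing[OF zero_le_one])
  then show ?thesis
    by (simp add: h_def d_def)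
qed

lemma is_argmin_gradient_eq_0:
  assumes "is_argmin \<psi> z" and "\<psi> differentiable (at z)"
  shows "gradient \<psi> z = 0"
proof -
  have "(\<psi> has_derivative (\<lambda>v. v \<bullet> gradient \<psi> z)) (at z)"
    using differentiable_GDERIV_gradient[OF assms(2)] by (simp add: gderiv_def)
  moreover have "\<psi> z \<le> \<psi> y" for y
    using assms(1) by (simp add: is_arg_min_linorder)
  ultimately have "(\<lambda>v. v \<bullet> gradient \<psi> z) = (\<lambda>v. 0)"
    using differential_zero_maxmin[of z UNIV \<psi>] by auto
  then show ?thesis
    by (metis inner_eq_zero_iff)
qed

text \<open>The minimum is at most the value after one gradient step of length \<open>1 / L\<close>,
  the step that minimises the quadratic upper bound at \<open>x\<close>.\<close>

lemma smooth_with_argmin_decrease: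
  assumes "smooth_with L \<psi>" and "L > 0" and "is_argmin \<psi> z"
  shows "\<psi> z \<le> \<psi> x - (norm (gradient \<psi> x))\<^sup>2 / (2 * L)"
proof -
  define y where "y = x - (1 / L) *\<^sub>R gradient \<psi> x"
  have "\<psi> z \<le> \<psi> y"
    using assms(3) by (simp add: is_arg_min_linorder)
  also have "\<dots> \<le> \<psi> x + gradient \<psi> x \<bullet> (y - x) + L / 2 * (norm (y - x))\<^sup>2"
    using smooth_with_quadratic_upper_bound[OF assms(1)] .
  also have "\<dots> = \<psi> x - (norm (gradient \<psi> x))\<^sup>2 / (2 * L)"
    using assms(2) by (simp add: y_def dot_square_norm power2_eq_square field_simps)
  finally show ?thesis .
qed

lemma strongly_convex_dist_critical_le:
  assumes "strongly_convex m \<psi>" and "gradient \<psi> z = 0"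
  shows "m * norm (x - z) \<le> norm (gradient \<psi> x)"
proof (cases "x = z")
  case False
  \<comment> \<open>Adding the strong convexity inequalities for \<open>(x, z)\<close> and
    \<open>(z, x)\<close> cancels the function values.\<close>
  have "m * (norm (x - z))\<^sup>2 \<le> gradient \<psi> x \<bullet> (x - z)"
    using strongly_convexD[OF assms(1), of z x] strongly_convexD[OF assms(1), of x z] assms(2)
    by (simp add: inner_diff_right norm_minus_commute)
  also have "\<dots> \<le> norm (gradient \<psi> x) * norm (x - z)"
    by (rule norm_cauchy_schwarz)
  finally show ?thesis
    using False by (simp add: power2_eq_square flip: mult.assoc)
qed simp

lemma strongly_convex_Polyak_Lojasiewicz:
  assumes "strongly_convex m \<psi>" and "m > 0"
  shows "\<psi> x - \<psi> y \<le> (norm (gradient \<psi> x))\<^sup>2 / (2 * m)"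
proof -
  define a where "a = norm (gradient \<psi> x)"
  define r where "r = norm (y - x)"
  have "- (gradient \<psi> x \<bullet> (y - x)) \<le> a * r"
    unfolding a_def r_def using norm_cauchy_schwarz[of "- gradient \<psi> x" "y - x"] by simp
  then have "\<psi> x - \<psi> y \<le> a * r - m / 2 * r\<^sup>2"
    using strongly_convexD[OF assms(1), of x y] by (simp add: r_def)
  \<comment> \<open>Completing the square in the unknown distance \<open>r\<close> makes the bound
    independent of \<open>y\<close>.\<close>
  also have "\<dots> = a\<^sup>2 / (2 * m) - (a - m * r)\<^sup>2 / (2 * m)"
    using assms(2) by (simp add: field_simps power2_eq_square)
  also have "\<dots> \<le> a\<^sup>2 / (2 * m)"
    using assms(2) by simp
  finally show ?thesis by (simp add: a_def)
qed

text \<open>At two points a unit distance apart, the quadratic lower and upper bounds share their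
  affine part, so only the moduli remain to be compared.\<close>

lemma strong_convexity_le_smoothness:
  fixes \<psi> :: "'a::euclidean_space \<Rightarrow> real"
  assumes "strongly_convex m \<psi>" and "smooth_with L \<psi>"
  shows "m \<le> L"
proof -
  obtain b :: 'a where "b \<in> Basis" using nonempty_Basis by blast
  then show ?thesis
    using strongly_convexD[OF assms(1), of 0 b] smooth_with_quadratic_upper_bound[OF assms(2), of b 0]
    by simp
qed

text \<open>Jensen's inequality via the tangent plane at the mean: the linear terms cancel on
  summation because the deviations from the mean add up to zero.\<close>

lemma strongly_convex_at_mean_le:
  assumes "strongly_convex m \<psi>" and "m \<ge> 0" and "K \<ge> 1"
    and "\<And>k. k \<in> {1..K} \<Longrightarrow> \<psi> (u k) \<le> c"
  shows "\<psi> ((1 / real K) *\<^sub>R (\<Sum>k=1..K. u k)) \<le> c"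
proof -
  define y where "y = (1 / real K) *\<^sub>R (\<Sum>k=1..K. u k)"
  have "\<psi> y + gradient \<psi> y \<bullet> (u k - y) \<le> c" if "k \<in> {1..K}" for k
  proof -
    have "0 \<le> m / 2 * (norm (u k - y))\<^sup>2"
      using assms(2) by simp
    then show ?thesis
      using strongly_convexD[OF assms(1), of y "u k"] assms(4)[OF that] by linarith
  qed
  then have "(\<Sum>k=1..K. \<psi> y + gradient \<psi> y \<bullet> (u k - y)) \<le> (\<Sum>k=1..K. c)"
    by (rule sum_mono)
  moreover have "(\<Sum>k=1..K. gradient \<psi> y \<bullet> (u k - y)) = gradient \<psi> y \<bullet> ((\<Sum>k=1..K. u k) - real K *\<^sub>R y)"
    by (simp add: inner_diff_right sum_subtractf inner_sum_right)
  moreover have "real K *\<^sub>R y = (\<Sum>k=1..K. u k)"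
    using assms(3) by (simp add: y_def)
  ultimately show ?thesis
    using assms(3) unfolding y_def[symmetric] by (simp add: sum.distrib)
qed

section \<open>Averages of the local functions\<close>

lemma GDERIV_average:
  assumes "\<And>k. k \<in> {1..K} \<Longrightarrow> GDERIV (F k) x :> G k"
  shows "GDERIV (average K F) x :> (1 / real K) *\<^sub>R (\<Sum>k=1..K. G k)"
proof -
  have "(average K F has_derivative (\<lambda>h. (1 / real K) * (\<Sum>k=1..K. h \<bullet> G k))) (at x)"
    unfolding average_def[abs_def] using assms
    by (intro has_derivative_mult_right has_derivative_sum) (simp add: gderiv_def)
  then show ?thesis
    by (simp add: gderiv_def inner_sum_right)
qed

lemma smooth_with_average:
  assumes "K \<ge> 1" and "\<And>k. k \<in> {1..K} \<Longrightarrow> smooth_with L (F k)"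
  shows "smooth_with L (average K F)"
proof (rule smooth_withI_GDERIV)
  show "GDERIV (average K F) x :> (1 / real K) *\<^sub>R (\<Sum>k=1..K. gradient (F k) x)" for x
    using assms(2) by (intro GDERIV_average smooth_withD_GDERIV)
  fix x y
  have "norm (\<Sum>k=1..K. gradient (F k) x - gradient (F k) y) \<le> (\<Sum>k=1..K. L * norm (x - y))"
    using assms(2) by (intro sum_norm_le) (simp add: smooth_with_def)
  then show "norm ((1 / real K) *\<^sub>R (\<Sum>k=1..K. gradient (F k) x)
      - (1 / real K) *\<^sub>R (\<Sum>k=1..K. gradient (F k) y)) \<le> L * norm (x - y)"
    using assms(1)
    unfolding scaleR_diff_right[symmetric] sum_subtractf[symmetric] norm_scaleR
    by (simp add: pos_divide_le_eq mult.commute)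
qed

lemma strongly_convex_average:
  assumes "K \<ge> 1" and "\<And>k. k \<in> {1..K} \<Longrightarrow> strongly_convex m (F k)"
  shows "strongly_convex m (average K F)"
proof (rule strongly_convexI_GDERIV)
  show "GDERIV (average K F) x :> (1 / real K) *\<^sub>R (\<Sum>k=1..K. gradient (F k) x)" for x
    using assms(2)
    by (intro GDERIV_average differentiable_GDERIV_gradient) (simp add: strongly_convex_def)
  fix x y
  have "(\<Sum>k=1..K. F k y + gradient (F k) y \<bullet> (x - y) + m / 2 * (norm (x - y))\<^sup>2) \<le> (\<Sum>k=1..K. F k x)"
    using assms(2) by (intro sum_mono strongly_convexD)
  then have "(\<Sum>k=1..K. F k y) + (\<Sum>k=1..K. gradient (F k) y) \<bullet> (x - y)
      + real K * (m / 2 * (norm (x - y))\<^sup>2) \<le> (\<Sum>k=1..K. F k x)"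
    by (simp add: sum.distrib inner_sum_left)
  then have "((\<Sum>k=1..K. F k y) + (\<Sum>k=1..K. gradient (F k) y) \<bullet> (x - y)
      + real K * (m / 2 * (norm (x - y))\<^sup>2)) / real K \<le> (\<Sum>k=1..K. F k x) / real K"
    by (rule divide_right_mono) simp
  then show "average K F y + (1 / real K) *\<^sub>R (\<Sum>k=1..K. gradient (F k) y) \<bullet> (x - y)
      + m / 2 * (norm (x - y))\<^sup>2 \<le> average K F x"
    using assms(1) by (simp add: average_def add_divide_distrib)
qed

section \<open>The local subproblem\<close>

lemma GDERIV_dane_subproblem:
  assumes "smooth_with L (F k)"
  shows "GDERIV (dane_subproblem K F \<mu> \<eta> k v) x :>
    gradient (F k) x - (gradient (F k) v - \<eta> *\<^sub>R gradient (average K F) v) + \<mu> *\<^sub>R (x - v)"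
proof -
  define c where "c = gradient (F k) v - \<eta> *\<^sub>R gradient (average K F) v"
  have "dane_subproblem K F \<mu> \<eta> k v = (\<lambda>x. F k x - c \<bullet> x + \<mu> / 2 * ((x - v) \<bullet> (x - v)))"
    by (simp add: fun_eq_iff dane_subproblem_def c_def power2_norm_eq_inner)
  moreover have "(F k has_derivative (\<lambda>h. h \<bullet> gradient (F k) x)) (at x)"
    using smooth_withD_GDERIV[OF assms] by (simp add: gderiv_def)
  then have "((\<lambda>x. F k x - c \<bullet> x + \<mu> / 2 * ((x - v) \<bullet> (x - v))) has_derivative
      (\<lambda>h. h \<bullet> (gradient (F k) x - c + \<mu> *\<^sub>R (x - v)))) (at x)"
    by (auto intro!: derivative_eq_intros simp: fun_eq_iff inner_diff_right inner_diff_left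
        inner_add_right inner_commute algebra_simps)
  ultimately show ?thesis
    by (simp add: gderiv_def c_def)
qed

text \<open>The linear correction cancels the local gradient at \<open>v\<close> and the proximal
  term is stationary there, so every subproblem starts along the same global direction.\<close>

lemma gradient_dane_subproblem_at_center:
  assumes "smooth_with L (F k)"
  shows "gradient (dane_subproblem K F \<mu> \<eta> k v) v = \<eta> *\<^sub>R gradient (average K F) v"
  using gradient_eqI[OF GDERIV_dane_subproblem[of L F k K \<mu> \<eta> v v, OF assms]] by simp

lemma smooth_with_dane_subproblem:
  assumes "smooth_with L (F k)" and "\<mu> \<ge> 0"
  shows "smooth_with (L + \<mu>) (dane_subproblem K F \<mu> \<eta> k v)"
proof (rule smooth_withI_GDERIV[OF GDERIV_dane_subproblem[where F = F and k = k, OF assms(1)]])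
  fix x y
  define c where "c = gradient (F k) v - \<eta> *\<^sub>R gradient (average K F) v"
  have "norm ((gradient (F k) x - c + \<mu> *\<^sub>R (x - v)) - (gradient (F k) y - c + \<mu> *\<^sub>R (y - v)))
      = norm ((gradient (F k) x - gradient (F k) y) + \<mu> *\<^sub>R (x - y))"
    by (simp add: algebra_simps)
  also have "\<dots> \<le> L * norm (x - y) + norm (\<mu> *\<^sub>R (x - y))"
    using assms(1) by (intro norm_triangle_le add_right_mono) (simp add: smooth_with_def)
  finally show "norm ((gradient (F k) x - c + \<mu> *\<^sub>R (x - v)) - (gradient (F k) y - c + \<mu> *\<^sub>R (y - v)))
      \<le> (L + \<mu>) * norm (x - y)"
    using assms(2) by (simp add: distrib_right)
qed

lemma strongly_convex_dane_subproblem: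
  assumes "smooth_with L (F k)" and "strongly_convex m (F k)"
  shows "strongly_convex (m + \<mu>) (dane_subproblem K F \<mu> \<eta> k v)"
proof (rule strongly_convexI_GDERIV[OF GDERIV_dane_subproblem[where F = F and k = k, OF assms(1)]])
  fix x y
  define c where "c = gradient (F k) v - \<eta> *\<^sub>R gradient (average K F) v"
  \<comment> \<open>The proximal term is expanded exactly around \<open>y\<close>, so it contributes
    its full \<mu> to the convexity modulus.\<close>
  have "(norm (x - v))\<^sup>2 = (norm (y - v))\<^sup>2 + 2 * ((y - v) \<bullet> (x - y)) + (norm (x - y))\<^sup>2"
    by (simp add: power2_norm_eq_inner inner_diff_left inner_diff_right inner_commute)
  then have "\<mu> / 2 * (norm (x - v))\<^sup>2
      = \<mu> / 2 * (norm (y - v))\<^sup>2 + \<mu> * ((y - v) \<bullet> (x - y)) + \<mu> / 2 * (norm (x - y))\<^sup>2"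
    by (simp add: distrib_left)
  then show "dane_subproblem K F \<mu> \<eta> k v y + (gradient (F k) y - c + \<mu> *\<^sub>R (y - v)) \<bullet> (x - y)
      + (m + \<mu>) / 2 * (norm (x - y))\<^sup>2 \<le> dane_subproblem K F \<mu> \<eta> k v x"
    using strongly_convexD[OF assms(2), of y x]
    unfolding dane_subproblem_def c_def[symmetric] inner_add_left inner_diff_left[of "gradient (F k) y"]
      inner_diff_right[of c]
    by (simp add: add_divide_distrib distrib_right)
qed

section \<open>Decrease at an inexact local solution, and the rate\<close>

lemma smooth_with_decrease_at_inexact_argmin:
  fixes f g :: "'a::euclidean_space \<Rightarrow> real"
  assumes f: "smooth_with L f" and L: "0 \<le> L"
    and g: "smooth_with A g" "strongly_convex B g" and AB: "0 < A" "0 < B"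
    and \<eta>: "0 < \<eta>" and \<gamma>: "0 \<le> \<gamma>"
    and grad: "gradient g v = \<eta> *\<^sub>R gradient f v"
    and z: "is_argmin g z" and u: "norm (u - z) \<le> \<gamma> * norm (v - z)"
  shows "f u \<le> f v - (\<eta> / (2 * A) - \<gamma> * \<eta> / B - L * ((1 + \<gamma>) * \<eta>)\<^sup>2 / (2 * B\<^sup>2)) * (norm (gradient f v))\<^sup>2"
proof -
  define n where "n = norm (gradient f v)"
  have dz: "norm (v - z) \<le> \<eta> * n / B"
    using strongly_convex_dist_critical_le[OF g(2) is_argmin_gradient_eq_0[OF z], of v] g(1) AB \<eta>
    by (simp add: smooth_with_def grad n_def field_simps)
  have uz: "norm (u - z) \<le> \<gamma> * (\<eta> * n / B)"
    using u mult_left_mono[OF dz \<gamma>] by linarith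
  have uv: "norm (u - v) \<le> (1 + \<gamma>) * \<eta> * n / B"
    using norm_triangle_ineq[of "u - z" "z - v"] uz dz
    by (simp add: norm_minus_commute algebra_simps add_divide_distrib)
  \<comment> \<open>Strong convexity at \<open>v\<close>, with its nonnegative quadratic term
    dropped, bounds the slope towards \<open>z\<close> by the decrease of \<open>g\<close>;
    smoothness of \<open>g\<close> then quantifies that decrease.\<close>
  have "\<eta> * (gradient f v \<bullet> (z - v)) \<le> g z - g v"
    using strongly_convexD[OF g(2), of v z] AB by (simp add: grad)
      (smt (verit) divide_nonneg_nonneg mult_nonneg_nonneg zero_le_power2)
  also have "\<dots> \<le> - (\<eta> * (\<eta> * n\<^sup>2 / (2 * A)))"
    using smooth_with_argmin_decrease[OF g(1) AB(1) z, of v] \<eta>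
    by (simp add: grad n_def power_mult_distrib power2_eq_square mult.assoc mult.left_commute)
  finally have "gradient f v \<bullet> (z - v) \<le> - (\<eta> * n\<^sup>2 / (2 * A))"
    using \<eta> by (simp only: mult_minus_right[symmetric] mult_le_cancel_left_pos)
  \<comment> \<open>The first-order price of inexactness, by Cauchy-Schwarz.\<close>
  moreover have "gradient f v \<bullet> (u - z) \<le> \<gamma> * \<eta> / B * n\<^sup>2"
    using norm_cauchy_schwarz[of "gradient f v" "u - z"] mult_left_mono[OF uz, of n]
    by (simp add: n_def power2_eq_square mult_ac)
  ultimately have lin: "gradient f v \<bullet> (u - v) \<le> - (\<eta> * n\<^sup>2 / (2 * A)) + \<gamma> * \<eta> / B * n\<^sup>2"
    by (simp add: inner_diff_right)
  have "L / 2 * (norm (u - v))\<^sup>2 \<le> L / 2 * ((1 + \<gamma>) * \<eta> * n / B)\<^sup>2"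
    using uv L by (intro mult_left_mono power_mono) auto
  also have "\<dots> = L * ((1 + \<gamma>) * \<eta>)\<^sup>2 / (2 * B\<^sup>2) * n\<^sup>2"
    by (simp add: power_divide power_mult_distrib)
  finally have "f u \<le> f v + (- (\<eta> * n\<^sup>2 / (2 * A)) + \<gamma> * \<eta> / B * n\<^sup>2)
      + L * ((1 + \<gamma>) * \<eta>)\<^sup>2 / (2 * B\<^sup>2) * n\<^sup>2"
    using smooth_with_quadratic_upper_bound[OF f, of u v] lin by linarith
  also have "\<dots> = f v - (\<eta> / (2 * A) - \<gamma> * \<eta> / B - L * ((1 + \<gamma>) * \<eta>)\<^sup>2 / (2 * B\<^sup>2)) * n\<^sup>2"
    by (simp add: left_diff_distrib)
  finally show ?thesis by (simp add: n_def)
qed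

text \<open>
  Positivity of the rate forces \<open>2\<gamma> \<le> (1 - \<gamma>)\<^sup>2\<close>, hence \<open>\<gamma> \<le> 2 - sqrt 3\<close> and \<open>(1 + \<gamma>)\<^sup>2 \<le> 2\<close>.
\<close>
lemma dane_rate_le:
  fixes A B L \<gamma> \<eta> lam :: real
  defines "\<rho> \<equiv> ((1 - \<gamma>)\<^sup>2 / (\<eta> * A) - 2 * L / B\<^sup>2 - 2 * \<gamma> * A / (\<eta> * B\<^sup>2)) * \<eta>\<^sup>2 * lam"
  assumes "0 < B" "B \<le> A" "0 \<le> L" "0 < \<eta>" "0 < lam" and \<gamma>: "0 \<le> \<gamma>" "\<gamma> < 1" and "0 < \<rho>"
  shows "\<rho> / (2 * lam) \<le> \<eta> / (2 * A) - \<gamma> * \<eta> / B - L * ((1 + \<gamma>) * \<eta>)\<^sup>2 / (2 * B\<^sup>2)"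
proof -
  have A: "0 < A" using assms by linarith
  have eq: "\<rho> / (2 * lam) = (1 - \<gamma>)\<^sup>2 * \<eta> / (2 * A) - L * \<eta>\<^sup>2 / B\<^sup>2 - \<gamma> * \<eta> * A / B\<^sup>2"
    using A assms(2-6) by (simp add: \<rho>_def field_simps power2_eq_square)
  have "1 / B \<le> A / B\<^sup>2"
    using assms(2,3) by (simp add: field_simps power2_eq_square)
  then have t3: "\<gamma> * \<eta> / B \<le> \<gamma> * \<eta> * A / B\<^sup>2"
    using mult_left_mono[of "1 / B" "A / B\<^sup>2" "\<gamma> * \<eta>"] \<gamma> assms(5) by simp
  have t1: "(1 - \<gamma>)\<^sup>2 * \<eta> / (2 * A) \<le> \<eta> / (2 * A)"
    using \<gamma> A assms(5) by (intro divide_right_mono) (auto simp: power_le_one)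
  \<comment> \<open>Discarding the \<open>L\<close> term and using
    \<open>1 / A \<le> 1 / B \<le> A / B\<^sup>2\<close> leaves a condition on \<gamma>
    alone.\<close>
  have "0 < \<rho> / (2 * lam)"
    using \<open>0 < \<rho>\<close> \<open>0 < lam\<close> by (intro divide_pos_pos) auto
  moreover have "0 \<le> L * \<eta>\<^sup>2 / B\<^sup>2"
    using assms by simp
  moreover have "1 / A \<le> 1 / B"
    using assms by (simp add: frac_le)
  then have "\<gamma> * \<eta> * (1 / A) \<le> \<gamma> * \<eta> * (1 / B)"
    using \<gamma> assms(5) by (intro mult_left_mono) auto
  ultimately have "\<gamma> * \<eta> / A < (1 - \<gamma>)\<^sup>2 * \<eta> / (2 * A)"
    using eq t3 by simp
  then have "2 * \<gamma> < (1 - \<gamma>)\<^sup>2"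
    using A assms(5) by (simp add: field_simps)
  then have "4 * \<gamma> < 1 + \<gamma>\<^sup>2"
    by (simp add: power2_diff)
  \<comment> \<open>This avoids the square root: it gives \<open>3 * \<gamma> < 1\<close>, hence
    \<open>(1 + \<gamma>)\<^sup>2 \<le> 1 + 3 * \<gamma> < 2\<close>.\<close>
  moreover have "\<gamma>\<^sup>2 \<le> \<gamma>"
    using \<gamma> by (simp add: power2_eq_square mult_left_le)
  ultimately have "(1 + \<gamma>)\<^sup>2 \<le> 2"
    by (simp add: power2_sum)
  then have "L * ((1 + \<gamma>) * \<eta>)\<^sup>2 / (2 * B\<^sup>2) \<le> L * (2 * \<eta>\<^sup>2) / (2 * B\<^sup>2)"
    unfolding power_mult_distrib using assms
    by (intro divide_right_mono mult_left_mono mult_right_mono) auto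
  then show ?thesis
    using eq t1 t3 by simp
qed

theorem theorem3:
  fixes F :: "nat \<Rightarrow> real ^ 'd \<Rightarrow> real"
    and K :: nat
    and L lam \<mu> \<eta> \<gamma> \<rho> :: real
    and w :: "nat \<Rightarrow> real ^ 'd"
    and w_hat :: "real ^ 'd"
  assumes "K \<ge> 1"
    and "\<And>k. k \<in> {1..K} \<Longrightarrow> smooth_with L (F k)"
    and "\<And>k. k \<in> {1..K} \<Longrightarrow> strongly_convex lam (F k)"
    and "lam > 0"
    and "is_argmin (average K F) w_hat"
    and "\<eta> > 0" and "0 \<le> \<gamma>" and "\<gamma> < 1" and "\<mu> > 0"
    and "\<rho> = ((1 - \<gamma>)\<^sup>2 / (\<eta> * (L + \<mu>)) - 2 * L / (lam + \<mu>)\<^sup>2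
                - 2 * \<gamma> * (L + \<mu>) / (\<eta> * (lam + \<mu>)\<^sup>2)) * \<eta>\<^sup>2 * lam"
    and "0 < \<rho>" and "\<rho> < 1"
    and "inexact_dane_II_run K F \<mu> \<eta> \<gamma> w"
  shows "\<forall>t\<ge>1. average K F (w t) - average K F w_hat
            \<le> (1 - \<rho>) * (average K F (w (t - 1)) - average K F w_hat)"
proof (intro allI impI)
  fix t :: nat assume t: "t \<ge> 1"
  define v where "v = w (t - 1)"
  define f where "f = average K F"
  obtain u where u: "\<And>k. k \<in> {1..K} \<Longrightarrow> \<exists>z. is_argmin (dane_subproblem K F \<mu> \<eta> k v) z \<and>
        norm (u k - z) \<le> \<gamma> * norm (v - z)"
    and wt: "w t = (1 / real K) *\<^sub>R (\<Sum>k=1..K. u k)"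
    using assms(13) t unfolding inexact_dane_II_run_def Let_def v_def by blast
  have f: "smooth_with L f" "strongly_convex lam f"
    unfolding f_def using assms(1-3) by (auto intro: smooth_with_average strongly_convex_average)
  \<comment> \<open>Supplies both the positivity of \<open>L\<close> and the ordering of the two
    subproblem moduli required by \<open>dane_rate_le\<close>.\<close>
  have lamL: "lam \<le> L"
    using strong_convexity_le_smoothness[OF f(2,1)] .
  define r where "r = \<rho> / (2 * lam)"
  have rate: "r \<le> \<eta> / (2 * (L + \<mu>)) - \<gamma> * \<eta> / (lam + \<mu>)
      - L * ((1 + \<gamma>) * \<eta>)\<^sup>2 / (2 * (lam + \<mu>)\<^sup>2)"
    unfolding r_def assms(10)
    using assms lamL by (intro dane_rate_le) auto
  have "f (u k) \<le> f v - r * (norm (gradient f v))\<^sup>2" if k: "k \<in> {1..K}" for k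
  proof -
    obtain z where "is_argmin (dane_subproblem K F \<mu> \<eta> k v) z" "norm (u k - z) \<le> \<gamma> * norm (v - z)"
      using u[OF k] by blast
    then have "f (u k) \<le> f v - (\<eta> / (2 * (L + \<mu>)) - \<gamma> * \<eta> / (lam + \<mu>)
        - L * ((1 + \<gamma>) * \<eta>)\<^sup>2 / (2 * (lam + \<mu>)\<^sup>2)) * (norm (gradient f v))\<^sup>2"
      using assms(2,3)[OF k] assms(4,6,7,9) lamL
      by (intro smooth_with_decrease_at_inexact_argmin[OF f(1) _ smooth_with_dane_subproblem
            strongly_convex_dane_subproblem])
        (auto simp: f_def gradient_dane_subproblem_at_center)
    moreover have "r * (norm (gradient f v))\<^sup>2 \<le> (\<eta> / (2 * (L + \<mu>)) - \<gamma> * \<eta> / (lam + \<mu>)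
        - L * ((1 + \<gamma>) * \<eta>)\<^sup>2 / (2 * (lam + \<mu>)\<^sup>2)) * (norm (gradient f v))\<^sup>2"
      using rate by (rule mult_right_mono) simp
    ultimately show ?thesis by linarith
  qed
  then have "f (w t) \<le> f v - r * (norm (gradient f v))\<^sup>2"
    unfolding wt using strongly_convex_at_mean_le[OF f(2)] assms(1,4) by simp
  \<comment> \<open>Since \<open>r = \<rho> / (2 * lam)\<close>, the right-hand side is exactly the
    decrease just obtained.\<close>
  moreover have "\<rho> * (f v - f w_hat) \<le> \<rho> * ((norm (gradient f v))\<^sup>2 / (2 * lam))"
    using strongly_convex_Polyak_Lojasiewicz[OF f(2) assms(4)] assms(11)
    by (intro mult_left_mono) auto
  ultimately show "average K F (w t) - average K F w_hat
      \<le> (1 - \<rho>) * (average K F (w (t - 1)) - average K F w_hat)"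
    unfolding f_def[symmetric] v_def[symmetric] by (simp add: r_def left_diff_distrib)
qed

end
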